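(* Let $\mathscr{H}$ be a Euclidean space, let $f:\mathscr{H}\to\,]-\infty,+\infty]$ be convex, closed and proper, and let $\mathcal{S}:\mathscr{H}\to\mathscr{H}$ be a bijective bounded linear operator with adjoint $\mathcal{S}^*$. Then, for every $\bm{v}\in\mathscr{H}$, $$\bm{v}=\mathbf{Prox}_{f\mathcal{S}^{-1}}(\bm{v})+\mathbf{Prox}_{f^*\mathcal{S}^*}(\bm{v}).$$
   Context: For a convex, closed, proper function $h$ and a bijective bounded linear operator $\mathcal{L}$ on $\mathscr{H}$, $\mathbf{Prox}_{h\mathcal{L}}(\bm{v})=\text{argmin}_{\bm{z}}\ h(\mathcal{L}\bm{z})+\frac12\Vert\bm{z}-\bm{v}\Vert^2$. The Fenchel conjugate is $f^*(\bm{u})=\sup_{\bm{z}}\langle\bm{z},\bm{u}\rangle-f(\bm{z})$. *)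

theory Defs
  imports "HOL-Analysis.Analysis"
begin

text \<open>
  Functions into \<open>]-\<infinity>,+\<infinity>]\<close> are rendered as \<^typ>\<open>'a \<Rightarrow> ereal\<close>; the exclusion of \<open>-\<infinity>\<close> is part of
  \<open>proper_ereal\<close>.  The library notions \<^const>\<open>convex_on\<close> and \<^const>\<open>epigraph\<close> only cover
  real-valued functions.
\<close>

definition proper_ereal :: "('a \<Rightarrow> ereal) \<Rightarrow> bool" where
  "proper_ereal f \<longleftrightarrow> (\<forall>x. f x \<noteq> -\<infinity>) \<and> (\<exists>x. f x \<noteq> \<infinity>)"

text \<open>In \<^typ>\<open>ereal\<close> we have \<open>0 * \<infinity> = 0\<close>, so the weights \<open>0\<close> and \<open>1\<close> impose no condition.\<close>

definition convex_ereal :: "('a::real_vector \<Rightarrow> ereal) \<Rightarrow> bool" where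
  "convex_ereal f \<longleftrightarrow>
    (\<forall>x y. \<forall>u\<ge>0. \<forall>v\<ge>0. u + v = 1 \<longrightarrow>
      f (u *\<^sub>R x + v *\<^sub>R y) \<le> ereal u * f x + ereal v * f y)"

definition epigraph_ereal :: "('a \<Rightarrow> ereal) \<Rightarrow> ('a \<times> real) set" where
  "epigraph_ereal f = {(x, t). f x \<le> ereal t}"

definition closed_ereal :: "('a::topological_space \<Rightarrow> ereal) \<Rightarrow> bool" where
  "closed_ereal f \<longleftrightarrow> closed (epigraph_ereal f)"

definition fenchel_conjugate :: "('a::real_inner \<Rightarrow> ereal) \<Rightarrow> 'a \<Rightarrow> ereal" where
  "fenchel_conjugate f u = (SUP z. ereal (z \<bullet> u) - f z)"

definition prox_objective ::
  "('b \<Rightarrow> ereal) \<Rightarrow> ('a::real_normed_vector \<Rightarrow> 'b) \<Rightarrow> 'a \<Rightarrow> 'a \<Rightarrow> ereal" where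
  "prox_objective h L v z = h (L z) + ereal (1 / 2 * (norm (z - v))\<^sup>2)"

text \<open>
  \<^const>\<open>arg_min\<close> is a choice operator: \<open>prox\<close> is meaningful only where the objective has exactly
  one minimizer.
\<close>

definition prox ::
  "('b \<Rightarrow> ereal) \<Rightarrow> ('a::real_normed_vector \<Rightarrow> 'b) \<Rightarrow> 'a \<Rightarrow> 'a" where
  "prox h L v = arg_min (prox_objective h L v) (\<lambda>_. True)"

end

theory Submission
  imports Defs
begin

text \<open>
  Put \<open>g = f \<circ> S\<^sup>-\<^sup>1\<close>.  A change of variables in the supremum gives \<open>g\<^sup>* = f\<^sup>* \<circ> S\<^sup>*\<close>, so the claim is
  Moreau's decomposition for \<open>g\<close>.  A closed convex proper function decreases at most linearly, so
  \<open>g + \<parallel>\<cdot> - v\<parallel>\<^sup>2 / 2\<close> attains its minimum at some \<open>p\<close>; by convexity \<open>q = v - p\<close> is a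
  subgradient of \<open>g\<close> at \<open>p\<close>.  The subgradient inequality is equivalent to
  \<open>g\<^sup>* q = \<langle>p, q\<rangle> - g p\<close>, and completing the square then shows that \<open>p\<close> and \<open>q\<close> are the unique
  minimizers of the two objectives.
\<close>

section \<open>Existence of a proximal minimizer\<close>

text \<open>The sublevel sets at real levels above the infimum \<open>m\<close> over
  \<open>K\<close> are closed and have the finite intersection property on \<open>K\<close>: the
  smallest of finitely many levels decides. By compactness they share a point of \<open>K\<close>,
  whose value cannot exceed \<open>m\<close>, since a real level would fit strictly between.\<close>

lemma closed_sublevels_attain_min_on_compact:
  fixes F :: "'a::t2_space \<Rightarrow> ereal"
  assumes "compact K" and "K \<noteq> {}" and cl: "\<And>t. closed {x. F x \<le> ereal t}"
  obtains x where "x \<in> K" and "\<And>y. y \<in> K \<Longrightarrow> F x \<le> F y"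
proof -
  define m where "m = (INF x\<in>K. F x)"
  have "K \<inter> (\<Inter>t\<in>{t. m < ereal t}. {x. F x \<le> ereal t}) \<noteq> {}"
  proof (rule compact_imp_fip_image[OF \<open>compact K\<close>])
    fix I assume I: "finite I" "I \<subseteq> {t. m < ereal t}"
    show "K \<inter> (\<Inter>t\<in>I. {x. F x \<le> ereal t}) \<noteq> {}"
    proof (cases "I = {}")
      case False
      then have "m < ereal (Min I)" using I Min_in by blast
      then obtain x where x: "x \<in> K" "F x < ereal (Min I)"
        unfolding m_def INF_less_iff by blast
      have "F x \<le> ereal t" if "t \<in> I" for t
        using x(2) Min_le[OF I(1) that] by (meson ereal_less_eq(3) less_imp_le order_trans)
      then show ?thesis using x(1) by blast
    qed (use \<open>K \<noteq> {}\<close> in auto)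
  qed (use cl in auto)
  then obtain x where "x \<in> K" and x: "\<And>t. m < ereal t \<Longrightarrow> F x \<le> ereal t"
    by auto
  have "F x \<le> m"
  proof (rule ccontr)
    assume "\<not> F x \<le> m"
    then obtain t where "m < ereal t" "ereal t < F x"
      using ereal_dense2[of m "F x"] by (auto simp: not_le)
    then show False using x[of t] by simp
  qed
  then have "F x \<le> F y" if "y \<in> K" for y
    using that unfolding m_def by (meson INF_lower order_trans)
  with \<open>x \<in> K\<close> show ?thesis by (rule that)
qed

text \<open>Turns closedness of the epigraph into closed sublevel sets, both for \<open>g\<close>
  itself (\<open>q = 0\<close>) and for the proximal objective (\<open>q\<close> the quadratic
  term).\<close>

lemma closed_sublevel_add_continuous:
  fixes g :: "'a::topological_space \<Rightarrow> ereal"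
  assumes "closed_ereal g" and "continuous_on UNIV q"
  shows "closed {x. g x + ereal (q x) \<le> ereal t}"
proof -
  have "g x + ereal (q x) \<le> ereal t \<longleftrightarrow> g x \<le> ereal (t - q x)" for x
    by (cases "g x") auto
  then have "{x. g x + ereal (q x) \<le> ereal t} = (\<lambda>x. (x, t - q x)) -` epigraph_ereal g"
    by (auto simp: epigraph_ereal_def)
  moreover have "closed ((\<lambda>x. (x, t - q x)) -` epigraph_ereal g)"
    using assms unfolding closed_ereal_def
    by (intro closed_vimage continuous_intros) auto
  ultimately show ?thesis by simp
qed

text \<open>Real upper bounds in place of the values of \<open>g\<close> keep the later estimates in
  real arithmetic.\<close>

lemma convex_erealD:
  assumes "convex_ereal g" and "g x \<le> ereal a" and "g y \<le> ereal b" and "0 \<le> t" and "t \<le> 1"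
  shows "g (x + t *\<^sub>R (y - x)) \<le> ereal (a + t * (b - a))"
proof -
  have "g ((1 - t) *\<^sub>R x + t *\<^sub>R y) \<le> ereal (1 - t) * g x + ereal t * g y"
    using assms unfolding convex_ereal_def by (metis diff_add_cancel diff_ge_0_iff_ge)
  also have "\<dots> \<le> ereal (1 - t) * ereal a + ereal t * ereal b"
    using assms by (intro add_mono ereal_mult_left_mono) auto
  also have "\<dots> = ereal (a + t * (b - a))"
    by (simp add: algebra_simps)
  also have "(1 - t) *\<^sub>R x + t *\<^sub>R y = x + t *\<^sub>R (y - x)"
    by (simp add: algebra_simps)
  finally show ?thesis .
qed

lemma norm_add_scaleR_sq:
  fixes w d :: "'a::real_inner"
  shows "(norm (w + t *\<^sub>R d))\<^sup>2 = (norm w)\<^sup>2 + 2 * t * (w \<bullet> d) + t\<^sup>2 * (norm d)\<^sup>2"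
  unfolding power2_norm_eq_inner
  by (simp add: inner_add_left inner_add_right inner_commute power2_eq_square algebra_simps)

lemma prox_objective_attains_min:
  fixes g :: "'a::euclidean_space \<Rightarrow> ereal"
  assumes cvx: "convex_ereal g" and cl: "closed_ereal g" and pr: "proper_ereal g"
  obtains p where "\<And>z. prox_objective g id v p \<le> prox_objective g id v z"
proof -
  obtain x0 a where a: "g x0 = ereal a"
    using pr unfolding proper_ereal_def by (metis ereal_cases)
  have nm: "g x \<noteq> -\<infinity>" for x using pr unfolding proper_ereal_def by simp
  define F where "F = prox_objective g id v"
  have F: "F z = g z + ereal (1 / 2 * (norm (z - v))\<^sup>2)" for z
    by (simp add: F_def prox_objective_def)
  have "closed {x. g x \<le> ereal t}" for t
    using closed_sublevel_add_continuous[OF cl, of "\<lambda>_. 0"] by (simp add: zero_ereal_def[symmetric])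
  then obtain y0 where y0: "y0 \<in> cball x0 1" "\<And>y. y \<in> cball x0 1 \<Longrightarrow> g y0 \<le> g y"
    using closed_sublevels_attain_min_on_compact[of "cball x0 1" g] by auto
  then have "g y0 \<le> ereal a" using a by (metis centre_in_cball zero_le_one)
  \<comment> \<open>This \<open>m\<close> is a finite lower bound of \<open>g\<close> on the unit
    ball around \<open>x0\<close>; convexity will extend it to a linear lower bound outside.\<close>
  then obtain m where m: "g y0 = ereal m" using nm[of y0] by (cases "g y0") auto
  define d where "d = norm (x0 - v)"
  \<comment> \<open>At distance \<open>r\<close> from \<open>x0\<close> the objective will be at
    least \<open>a + d\<^sup>2 / 2 + r * (r / 2 - (a - m + d))\<close>, which is at least its value
    at \<open>x0\<close> once \<open>r\<close> reaches \<open>2 * (a - m + d)\<close>. The bound 1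
    makes \<open>1 / r\<close> an admissible convex weight.\<close>
  define R where "R = max 1 (2 * (a - m + d) + 1)"
  have far: "F x0 \<le> F z" if z: "z \<notin> cball x0 R" for z
  proof (cases "g z")
    case PInf
    then show ?thesis by (simp add: F)
  next
    case MInf
    with nm show ?thesis by simp
  next
    case (real b)
    define r where "r = norm (z - x0)"
    have r: "1 < r" "2 * (a - m + d) < r"
      using z by (auto simp: r_def R_def dist_norm norm_minus_commute)
    \<comment> \<open>The point of the segment from \<open>x0\<close> to \<open>z\<close> at
      distance 1 from \<open>x0\<close>: \<open>g\<close> is at least \<open>m\<close> there, and
      convexity turns this into a lower bound for \<open>g z\<close>.\<close>
    have "x0 + (1 / r) *\<^sub>R (z - x0) \<in> cball x0 1"
      using r by (simp add: dist_norm r_def)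
    then have "ereal m \<le> g (x0 + (1 / r) *\<^sub>R (z - x0))"
      using y0(2) m by metis
    also have "\<dots> \<le> ereal (a + 1 / r * (b - a))"
      by (rule convex_erealD[OF cvx]) (use a real r in auto)
    finally have "m \<le> a + (b - a) / r" by simp
    then have "m * r \<le> a * r + (b - a)"
      using r by (simp add: field_simps)
    then have b: "a - r * (a - m) \<le> b"
      by (simp add: algebra_simps)
    have zv: "z - v = (x0 - v) + 1 *\<^sub>R (z - x0)" by simp
    have "(norm (z - v))\<^sup>2 = d\<^sup>2 + 2 * ((x0 - v) \<bullet> (z - x0)) + r\<^sup>2"
      unfolding zv norm_add_scaleR_sq by (simp add: d_def r_def)
    moreover have "- (d * r) \<le> (x0 - v) \<bullet> (z - x0)"
      using Cauchy_Schwarz_ineq2[of "x0 - v" "z - x0"] by (simp add: d_def r_def)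
    moreover have "2 * (a - m + d) * r \<le> r * r"
      using r by (intro mult_right_mono) auto
    ultimately have "a + 1 / 2 * d\<^sup>2 \<le> b + 1 / 2 * (norm (z - v))\<^sup>2"
      using b by (simp add: algebra_simps power2_eq_square)
    then show ?thesis by (simp add: F a real d_def)
  qed
  have "closed {x. F x \<le> ereal t}" for t
    unfolding F by (rule closed_sublevel_add_continuous[OF cl]) (intro continuous_intros)
  moreover have x0: "x0 \<in> cball x0 R" by (simp add: R_def)
  ultimately obtain p where "\<And>y. y \<in> cball x0 R \<Longrightarrow> F p \<le> F y"
    using closed_sublevels_attain_min_on_compact[OF compact_cball, of x0 R F] by blast
  then have "F p \<le> F z" for z
    using far x0 by (metis order_trans)
  then show ?thesis using that unfolding F_def by blast
qed

section \<open>Optimality, subgradients and the conjugate\<close>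

text \<open>First-order optimality without derivatives: compare \<open>p\<close> with
  \<open>p + t *\<^sub>R (z - p)\<close>, bound \<open>g\<close> there by convexity, divide by
  \<open>t\<close> and let \<open>t\<close> tend to 0, so that the quadratic remainder
  vanishes.\<close>

lemma prox_minimizer_subgradient:
  fixes g :: "'a::real_inner \<Rightarrow> ereal"
  assumes cvx: "convex_ereal g" and pr: "proper_ereal g"
    and min: "\<And>z. prox_objective g id v p \<le> prox_objective g id v z"
  shows "g p \<noteq> \<infinity>" and "g p + ereal ((v - p) \<bullet> (z - p)) \<le> g z"
proof -
  have nm: "g x \<noteq> -\<infinity>" for x using pr unfolding proper_ereal_def by simp
  obtain x0 where "g x0 \<noteq> \<infinity>" using pr unfolding proper_ereal_def by blast
  then show fin: "g p \<noteq> \<infinity>"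
    using min[of x0] by (cases "g x0") (auto simp: prox_objective_def)
  then obtain a where a: "g p = ereal a" using nm[of p] by (cases "g p") auto
  show "g p + ereal ((v - p) \<bullet> (z - p)) \<le> g z"
  proof (cases "g z")
    case (real b)
    define w where "w = 1 / 2 * (norm (z - p))\<^sup>2"
    have step: "(v - p) \<bullet> (z - p) \<le> b - a + t * w" if t: "0 < t" "t \<le> 1" for t
    proof -
      let ?y = "p + t *\<^sub>R (z - p)"
      have y: "?y - v = (p - v) + t *\<^sub>R (z - p)" by simp
      have sq: "1 / 2 * (norm (?y - v))\<^sup>2
          = 1 / 2 * (norm (p - v))\<^sup>2 + t * ((p - v) \<bullet> (z - p)) + t\<^sup>2 * w"
        unfolding y norm_add_scaleR_sq by (simp add: w_def algebra_simps)
      have "ereal (a + 1 / 2 * (norm (p - v))\<^sup>2) \<le> g ?y + ereal (1 / 2 * (norm (?y - v))\<^sup>2)"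
        using min[of ?y] a by (simp add: prox_objective_def)
      also have "\<dots> \<le> ereal (a + t * (b - a)) + ereal (1 / 2 * (norm (?y - v))\<^sup>2)"
        using a real t by (intro add_right_mono convex_erealD[OF cvx]) auto
      finally have "0 \<le> t * (b - a) + t * ((p - v) \<bullet> (z - p)) + t\<^sup>2 * w"
        using sq by simp
      also have "\<dots> = t * (b - a - (v - p) \<bullet> (z - p) + t * w)"
        by (simp add: algebra_simps power2_eq_square)
      finally have "0 \<le> b - a - (v - p) \<bullet> (z - p) + t * w"
        using t by (simp add: zero_le_mult_iff)
      then show ?thesis by simp
    qed
    have "((\<lambda>t. b - a + t * w) \<longlongrightarrow> b - a + 0 * w) (at_right 0)"
      by (intro tendsto_intros)
    moreover have "eventually (\<lambda>t. (v - p) \<bullet> (z - p) \<le> b - a + t * w) (at_right 0)"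
      using step by (auto simp: eventually_at_right_field intro!: exI[of _ 1])
    ultimately have "(v - p) \<bullet> (z - p) \<le> b - a + 0 * w"
      by (rule tendsto_lowerbound) simp
    then show ?thesis by (simp add: a real)
  qed (use nm in auto)
qed

text \<open>Rearranged, the subgradient inequality says that \<open>z \<bullet> q - g z\<close> is
  largest at \<open>z = p\<close>, so the supremum is attained there.\<close>

lemma fenchel_conjugate_eq_at_subgradient:
  assumes a: "g p = ereal a" and sub: "\<And>z. g p + ereal (q \<bullet> (z - p)) \<le> g z"
  shows "fenchel_conjugate g q = ereal (p \<bullet> q - a)"
  unfolding fenchel_conjugate_def
proof (rule antisym)
  show "(SUP z. ereal (z \<bullet> q) - g z) \<le> ereal (p \<bullet> q - a)"
  proof (rule SUP_least)
    fix z
    show "ereal (z \<bullet> q) - g z \<le> ereal (p \<bullet> q - a)"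
      using sub[of z] a by (cases "g z") (auto simp: inner_diff_right inner_commute)
  qed
  show "ereal (p \<bullet> q - a) \<le> (SUP z. ereal (z \<bullet> q) - g z)"
    using a by (intro SUP_upper2[of p]) auto
qed

text \<open>Quadratic growth away from \<open>p\<close> excludes any other minimizer, so the choice
  made by \<open>arg_min\<close> is forced.\<close>

lemma ex1_is_arg_min_and_arg_min_eqI:
  fixes F :: "'a::real_normed_vector \<Rightarrow> ereal"
  assumes fin: "F p = ereal c" and lb: "\<And>z. ereal (c + 1 / 2 * (norm (z - p))\<^sup>2) \<le> F z"
  shows "\<exists>!z. is_arg_min F (\<lambda>_. True) z" and "arg_min F (\<lambda>_. True) = p"
proof -
  have "F p \<le> F z" for z
    using fin lb[of z] by (simp add: order_trans[rotated])
  then have p: "is_arg_min F (\<lambda>_. True) p"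
    by (auto simp: is_arg_min_def not_less)
  moreover have uniq: "z = p" if "is_arg_min F (\<lambda>_. True) z" for z
  proof -
    have "F z \<le> ereal c" using that fin by (metis is_arg_min_def not_less)
    with lb[of z] have "ereal (c + 1 / 2 * (norm (z - p))\<^sup>2) \<le> ereal c"
      by (rule order_trans)
    then show ?thesis by simp
  qed
  ultimately show "\<exists>!z. is_arg_min F (\<lambda>_. True) z" by blast
  show "arg_min F (\<lambda>_. True) = p"
    unfolding arg_min_def using p uniq by (rule some_equality)
qed

section \<open>Moreau's decomposition\<close>

proposition Moreau_decomposition:
  fixes g :: "'a::euclidean_space \<Rightarrow> ereal"
  assumes cvx: "convex_ereal g" and "closed_ereal g" and pr: "proper_ereal g"
  shows "\<exists>!z. is_arg_min (prox_objective g id v) (\<lambda>_. True) z"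
    and "\<exists>!z. is_arg_min (prox_objective (fenchel_conjugate g) id v) (\<lambda>_. True) z"
    and "v = prox g id v + prox (fenchel_conjugate g) id v"
proof -
  obtain p where min: "\<And>z. prox_objective g id v p \<le> prox_objective g id v z"
    using prox_objective_attains_min[OF assms] by blast
  note sub = prox_minimizer_subgradient[OF cvx pr min]
  obtain a where a: "g p = ereal a"
    using sub(1) pr unfolding proper_ereal_def by (cases "g p") auto
  define q where "q = v - p"
  have gq: "fenchel_conjugate g q = ereal (p \<bullet> q - a)"
    using a sub(2) unfolding q_def by (rule fenchel_conjugate_eq_at_subgradient)
  have primal: "ereal (a + 1 / 2 * (norm q)\<^sup>2 + 1 / 2 * (norm (z - p))\<^sup>2) \<le> prox_objective g id v z"
    for z
  proof -
    \<comment> \<open>Expanding the square around \<open>p\<close> leaves the cross term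
      \<open>- (q \<bullet> (z - p))\<close>, which the subgradient inequality compensates.\<close>
    have zv: "z - v = - q + 1 *\<^sub>R (z - p)" by (simp add: q_def)
    have "(norm (z - v))\<^sup>2 = (norm q)\<^sup>2 - 2 * (q \<bullet> (z - p)) + (norm (z - p))\<^sup>2"
      unfolding zv norm_add_scaleR_sq by simp
    then have "ereal (a + 1 / 2 * (norm q)\<^sup>2 + 1 / 2 * (norm (z - p))\<^sup>2)
        = (g p + ereal (q \<bullet> (z - p))) + ereal (1 / 2 * (norm (z - v))\<^sup>2)"
      by (simp add: a add_divide_distrib diff_divide_distrib)
    also have "\<dots> \<le> g z + ereal (1 / 2 * (norm (z - v))\<^sup>2)"
      using sub(2)[of z] unfolding q_def by (rule add_right_mono)
    finally show ?thesis by (simp add: prox_objective_def)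
  qed
  have dual: "ereal (p \<bullet> q - a + 1 / 2 * (norm p)\<^sup>2 + 1 / 2 * (norm (u - q))\<^sup>2)
      \<le> prox_objective (fenchel_conjugate g) id v u" for u
  proof -
    \<comment> \<open>Here the cross term is \<open>- (p \<bullet> (u - q))\<close>, compensated by
      the Fenchel-Young inequality, that is, by the term \<open>z = p\<close> of the supremum. The
      dual minimizer thus requires no second compactness argument.\<close>
    have uv: "u - v = - p + 1 *\<^sub>R (u - q)" by (simp add: q_def)
    have "(norm (u - v))\<^sup>2 = (norm p)\<^sup>2 - 2 * (p \<bullet> (u - q)) + (norm (u - q))\<^sup>2"
      unfolding uv norm_add_scaleR_sq by simp
    then have "ereal (p \<bullet> q - a + 1 / 2 * (norm p)\<^sup>2 + 1 / 2 * (norm (u - q))\<^sup>2)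
        = (ereal (p \<bullet> u) - g p) + ereal (1 / 2 * (norm (u - v))\<^sup>2)"
      by (simp add: a inner_diff_right add_divide_distrib diff_divide_distrib)
    also have "\<dots> \<le> fenchel_conjugate g u + ereal (1 / 2 * (norm (u - v))\<^sup>2)"
      unfolding fenchel_conjugate_def by (intro add_right_mono SUP_upper) simp
    finally show ?thesis by (simp add: prox_objective_def)
  qed
  have "prox_objective g id v p = ereal (a + 1 / 2 * (norm q)\<^sup>2)"
    by (simp add: prox_objective_def a q_def norm_minus_commute)
  note P = ex1_is_arg_min_and_arg_min_eqI[OF this primal]
  have "prox_objective (fenchel_conjugate g) id v q = ereal (p \<bullet> q - a + 1 / 2 * (norm p)\<^sup>2)"
    by (simp add: prox_objective_def gq) (simp add: q_def)
  note D = ex1_is_arg_min_and_arg_min_eqI[OF this dual]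
  show "\<exists>!z. is_arg_min (prox_objective g id v) (\<lambda>_. True) z" by (rule P(1))
  show "\<exists>!z. is_arg_min (prox_objective (fenchel_conjugate g) id v) (\<lambda>_. True) z" by (rule D(1))
  show "v = prox g id v + prox (fenchel_conjugate g) id v"
    unfolding prox_def P(2) D(2) by (simp add: q_def)
qed

section \<open>Composition with a linear bijection\<close>

lemma convex_ereal_comp_linear:
  assumes "convex_ereal f" and "linear T"
  shows "convex_ereal (f \<circ> T)"
  using assms by (simp add: convex_ereal_def linear_add linear_scale)

lemma closed_ereal_comp_continuous:
  assumes "closed_ereal f" and "continuous_on UNIV T"
  shows "closed_ereal (f \<circ> T)"
proof -
  have "epigraph_ereal (f \<circ> T) = (\<lambda>(x, t). (T x, t)) -` epigraph_ereal f"
    by (auto simp: epigraph_ereal_def)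
  moreover have "continuous_on UNIV (\<lambda>(x, t::real). (T x, t))"
    unfolding case_prod_beta
    by (intro continuous_intros continuous_on_compose2[OF assms(2)]) auto
  ultimately show ?thesis
    using assms(1) unfolding closed_ereal_def by (simp add: closed_vimage)
qed

lemma proper_ereal_comp_surj:
  assumes "proper_ereal f" and "surj T"
  shows "proper_ereal (f \<circ> T)"
  using assms unfolding proper_ereal_def by (metis comp_apply surjD)

text \<open>Substitute \<open>z = S w\<close>, which reaches every \<open>z\<close> by surjectivity;
  then \<open>inv S\<close> cancels and \<open>S\<close> moves to the other side of the inner
  product as its adjoint.\<close>

lemma fenchel_conjugate_comp_inv:
  fixes f :: "'a::euclidean_space \<Rightarrow> ereal" and S :: "'a \<Rightarrow> 'b::euclidean_space"
  assumes "linear S" and "bij S"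
  shows "fenchel_conjugate (f \<circ> inv S) = fenchel_conjugate f \<circ> adjoint S"
proof
  fix u
  have "(SUP z. ereal (z \<bullet> u) - f (inv S z)) = (SUP z\<in>range S. ereal (z \<bullet> u) - f (inv S z))"
    using assms(2) by (simp add: bij_is_surj)
  also have "\<dots> = (SUP w. ereal (w \<bullet> adjoint S u) - f w)"
    using assms by (simp add: image_comp comp_def bij_is_inj adjoint_works)
  finally show "fenchel_conjugate (f \<circ> inv S) u = (fenchel_conjugate f \<circ> adjoint S) u"
    by (simp add: fenchel_conjugate_def)
qed

lemma prox_objective_comp: "prox_objective h L v = prox_objective (h \<circ> L) id v"
  by (simp add: prox_objective_def fun_eq_iff)

text \<open>Unique existence of both minimizers is part of the conclusion because
  \<open>prox\<close> is a choice operator: only then does the equation speak about the true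
  proximal points.\<close>

theorem proposition5p3:
  fixes f :: "'a::euclidean_space \<Rightarrow> ereal" and S :: "'a \<Rightarrow> 'a" and v :: 'a
  assumes "convex_ereal f" and "closed_ereal f" and "proper_ereal f"
    and "bounded_linear S" and "bij S"
  shows "(\<exists>!z. is_arg_min (prox_objective f (inv S) v) (\<lambda>_. True) z)
    \<and> (\<exists>!z. is_arg_min (prox_objective (fenchel_conjugate f) (adjoint S) v) (\<lambda>_. True) z)
    \<and> v = prox f (inv S) v + prox (fenchel_conjugate f) (adjoint S) v"
proof -
  have S: "linear S" using assms(4) by (rule bounded_linear.linear)
  have inv: "linear (inv S)" "surj (inv S)"
    using S \<open>bij S\<close>
    by (simp_all add: inj_linear_imp_inv_linear bij_is_inj bij_is_surj bij_imp_bij_inv)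
  \<comment> \<open>In finite dimension the linear map \<open>inv S\<close> is bounded, hence
    continuous, which gives closedness.\<close>
  have "convex_ereal (f \<circ> inv S)" "closed_ereal (f \<circ> inv S)" "proper_ereal (f \<circ> inv S)"
    using assms inv
    by (auto intro: convex_ereal_comp_linear closed_ereal_comp_continuous proper_ereal_comp_surj
        linear_continuous_on linear_conv_bounded_linear[THEN iffD1])
  note M = Moreau_decomposition[OF this, of v]
  have "prox_objective f (inv S) v = prox_objective (f \<circ> inv S) id v"
    and "prox_objective (fenchel_conjugate f) (adjoint S) v
      = prox_objective (fenchel_conjugate (f \<circ> inv S)) id v"
    using prox_objective_comp fenchel_conjugate_comp_inv[OF S \<open>bij S\<close>] by metis+
  then show ?thesis using M by (simp add: prox_def)
qed

end
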